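(* Let $A\in\mathbb{C}^{n,n}$, $B\in\mathbb{C}^{n,m}$ be such that there exists $K\in\mathbb{C}^{m,n}$ with $zI_n-A-BK$ invertible for all $z\in\mathbb{C}$, $|z|\ge1$. Let $Q=Q'\in\mathbb{C}^{n+m,n+m}$, $\sigma(x,u)=[x;u]'Q[x;u]$, and suppose that the matrix $\Pi(z)=[(zI_n-A)^{-1}B;\,I_m]'Q[(zI_n-A)^{-1}B;\,I_m]$ is positive definite for all $z$ with $|z|=1$ except possibly finitely many. Let $P=P'\in\mathbb{C}^{n,n}$, $C\in\mathbb{C}^{m,n}$, $D\in\mathbb{C}^{m,m}$ satisfy $$\sigma(x,u)+x'Px-(Ax+Bu)'P(Ax+Bu)=|Cx+Du|^2\quad\forall\,x\in\mathbb{C}^n,u\in\mathbb{C}^m,\qquad \det\begin{bmatrix}\lambda A-I_n&\lambda B\\ C&D\end{bmatrix}\ne0\ \ \forall\,|\lambda|<1.$$ Fix $a\in\mathbb{C}^n$ and call a pair of sequences $x:\mathbb{Z}_+\to\mathbb{C}^n$, $u:\mathbb{Z}_+\to\mathbb{C}^m$ feasible if $x(t+1)=Ax(t)+Bu(t)$ for all $t\in\mathbb{Z}_+$, $x(0)=a$, and $\sum_{t=0}^\infty(|x(t)|^2+|u(t)|^2)<\infty$; for such a pair let $\Phi(x,u)=\sum_{t=0}^\infty\sigma(x(t),u(t))$. Then the infimum of $\Phi$ over all feasible pairs equals $-a'Pa$, and for any sequence $(x_i,u_i)$, $i=1,2,\dots$, of feasible pairs, $\sum_{t=0}^\infty|Cx_i(t)+Du_i(t)|^2\to0$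 as $i\to\infty$ if and only if $\Phi(x_i,u_i)\to -a'Pa$.
   Context: $\mathbb{Z}_+=\{0,1,2,\dots\}$. $M'$ denotes the conjugate transpose of $M$; $[x;u]$ denotes the stacked column vector. *)

theory Defs
  imports "HOL-Analysis.Analysis"
begin

text \<open>Complex matrices of fixed (type-indexed) sizes: C^{n,n} is complex^'n^'n,
  C^{n,m} is complex^'m^'n, and C^{n+m} is indexed by the sum type 'n + 'm.\<close>

definition cadj :: "complex^'n^'m \<Rightarrow> complex^'m^'n" where
  "cadj M = (\<chi> i j. cnj (M $ j $ i))"

definition qf :: "complex^'n^'n \<Rightarrow> complex^'n \<Rightarrow> complex" where
  "qf M x = (\<Sum>i\<in>UNIV. \<Sum>j\<in>UNIV. cnj (x $ i) * M $ i $ j * x $ j)"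

definition cposdef :: "complex^'n^'n \<Rightarrow> bool" where
  "cposdef M \<longleftrightarrow> cadj M = M \<and> (\<forall>v. v \<noteq> 0 \<longrightarrow> qf M v \<in> \<real> \<and> Re (qf M v) > 0)"

definition stackv :: "complex^'n \<Rightarrow> complex^'m \<Rightarrow> complex^('n + 'm)" where
  "stackv x u = (\<chi> k. case k of Inl i \<Rightarrow> x $ i | Inr j \<Rightarrow> u $ j)"

definition stackm :: "complex^'k^'n \<Rightarrow> complex^'k^'m \<Rightarrow> complex^'k^('n + 'm)" where
  "stackm M N = (\<chi> k. case k of Inl i \<Rightarrow> M $ i | Inr j \<Rightarrow> N $ j)"

definition blockm :: "complex^'n^'n \<Rightarrow> complex^'m^'n \<Rightarrow> complex^'n^'m \<Rightarrow> complex^'m^'m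
    \<Rightarrow> complex^('n + 'm)^('n + 'm)" where
  "blockm M11 M12 M21 M22 = (\<chi> k l. case k of
      Inl i \<Rightarrow> (case l of Inl j \<Rightarrow> M11 $ i $ j | Inr j \<Rightarrow> M12 $ i $ j)
    | Inr i \<Rightarrow> (case l of Inl j \<Rightarrow> M21 $ i $ j | Inr j \<Rightarrow> M22 $ i $ j))"

definition sigma :: "complex^('n + 'm)^('n + 'm) \<Rightarrow> complex^'n \<Rightarrow> complex^'m \<Rightarrow> complex" where
  "sigma Q x u = qf Q (stackv x u)"

definition Pifun :: "complex^'n^'n \<Rightarrow> complex^'m^'n \<Rightarrow> complex^('n + 'm)^('n + 'm)
    \<Rightarrow> complex \<Rightarrow> complex^'m^'m" where
  "Pifun A B Q z = (let M = stackm (matrix_inv (mat z - A) ** B) (mat 1)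
                    in cadj M ** Q ** M)"

definition feasible :: "complex^'n^'n \<Rightarrow> complex^'m^'n \<Rightarrow> complex^'n
    \<Rightarrow> (nat \<Rightarrow> complex^'n) \<Rightarrow> (nat \<Rightarrow> complex^'m) \<Rightarrow> bool" where
  "feasible A B a x u \<longleftrightarrow> (\<forall>t. x (Suc t) = A *v x t + B *v u t) \<and> x 0 = a
     \<and> summable (\<lambda>t. (norm (x t))\<^sup>2 + (norm (u t))\<^sup>2)"

text \<open>Phi(x,u) = sum_t sigma(x(t),u(t)); sigma is real-valued since Q is Hermitian.\<close>
definition Phi :: "complex^('n + 'm)^('n + 'm) \<Rightarrow> (nat \<Rightarrow> complex^'n) \<Rightarrow> (nat \<Rightarrow> complex^'m) \<Rightarrow> real" where
  "Phi Q x u = (\<Sum>t. Re (sigma Q (x t) (u t)))"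

end

theory Submission
  imports Defs "HOL-Computational_Algebra.Fundamental_Theorem_Algebra"
begin

text \<open>
  Telescoping the identity for \<open>P\<close> along a feasible pair gives \<open>\<Phi>(x,u) = \<Sum> |Cx + Du|\<^sup>2 - a'Pa\<close>,
  so everything reduces to finding feasible pairs whose output \<open>Cx + Du\<close> has arbitrarily small energy.
  A sequence of feasible outputs minimising the energy converges in \<open>\<ell>\<^sup>2\<close> to some \<open>z\<close>
  that is orthogonal to all outputs starting from the state 0. Hence
  \<open>p\<^sub>t(\<xi>) = \<langle>z(t + \<cdot>), output from \<xi>\<rangle>\<close> does not depend on the chosen trajectory, and dynamic programming
  gives \<open>p\<^sub>t(\<xi>) = \<langle>z(t), C\<xi> + Dw\<rangle> + p\<^bsub>t+1\<^esub>(A\<xi> + Bw)\<close> for all \<open>\<xi>\<close> and \<open>w\<close>. The determinant condition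
  makes \<open>D\<close> invertible and puts the spectrum of \<open>M = A - BD\<^sup>-\<^sup>1C\<close> in the closed unit disc; the choice
  \<open>w = -D\<^sup>-\<^sup>1C\<xi>\<close> yields \<open>p\<^sub>t = p\<^bsub>t+1\<^esub> \<circ> M\<close>. Since \<open>p\<^sub>t \<rightarrow> 0\<close>, this forces \<open>p = 0\<close>, and then \<open>z = 0\<close>.
\<close>

section \<open>Annihilating polynomials of a matrix\<close>

text \<open>Horner evaluation of \<open>p\<close> at the matrix \<open>M\<close>: each coefficient
  enters as a scalar matrix, and products are \<open>**\<close>.\<close>

definition poly_mat :: "complex^'n^'n \<Rightarrow> complex poly \<Rightarrow> complex^'n^'n" where
  "poly_mat M p = fold_coeffs (\<lambda>a X. mat a + M ** X) p 0"

lemma poly_mat_0 [simp]: "poly_mat M 0 = 0"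
  by (simp add: poly_mat_def)

lemma poly_mat_pCons: "poly_mat M (pCons a p) = mat a + M ** poly_mat M p"
  by (cases "a = 0 \<and> p = 0") (auto simp: poly_mat_def)

section \<open>Scalar matrices and evaluation of polynomials at a matrix\<close>

lemma mat_matrix_mult: "mat c ** X = (\<chi> i j. c * X $ i $ j)"
  for X :: "complex^'m^'n"
  by (auto simp: matrix_matrix_mult_def mat_def vec_eq_iff if_distrib if_distribR cong: if_cong)

lemma matrix_mult_mat_commute: "X ** mat c = mat c ** X"
  for X :: "complex^'m^'n"
  by (auto simp: matrix_matrix_mult_def mat_def vec_eq_iff if_distrib if_distribR cong: if_cong)

lemma mat_mult_vector: "mat c *v x = c *s x"
  for x :: "complex^'n"
  by (auto simp: matrix_vector_mult_def mat_def vec_eq_iff if_distrib if_distribR cong: if_cong)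

lemma mat_add: "mat (a + b) = mat a + mat b"
  for a :: complex
  by (simp add: mat_def vec_eq_iff)

lemma mat_mult: "mat (a * b) = mat a ** mat b"
  for a :: complex
  by (simp add: mat_matrix_mult) (simp add: mat_def vec_eq_iff)

lemma mat_of_real_mult: "mat (complex_of_real r) ** X = r *\<^sub>R X"
  for X :: "complex^'m^'n"
  by (simp add: mat_matrix_mult vec_eq_iff) (simp add: scaleR_conv_of_real)

lemma matrix_mult_add_left: "(X + Z) ** Y = X ** Y + Z ** Y"
  for X :: "complex^'m^'n" and Y :: "complex^'k^'m"
  by (simp add: matrix_matrix_mult_def vec_eq_iff algebra_simps sum.distrib)

lemma matrix_mult_diff_right: "X ** (Y - Z) = X ** Y - X ** Z"
  for X :: "complex^'m^'n" and Y :: "complex^'k^'m"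
  by (simp add: matrix_matrix_mult_def vec_eq_iff algebra_simps sum_subtractf)

lemma matrix_mult_zero_right: "X ** 0 = 0"
  for X :: "complex^'m^'n"
  by (simp add: matrix_matrix_mult_def vec_eq_iff)

lemma poly_mat_add: "poly_mat M (p + q) = poly_mat M p + poly_mat M q"
  by (induction p q rule: poly_induct2) (simp_all add: poly_mat_pCons mat_add matrix_add_ldistrib)

lemma poly_mat_smult: "poly_mat M (smult c p) = mat c ** poly_mat M p"
proof (induction p)
  case 0
  show ?case by (simp add: matrix_mult_zero_right)
next
  case (pCons a p)
  have "M ** (mat c ** poly_mat M p) = mat c ** (M ** poly_mat M p)"
    by (simp add: matrix_mul_assoc matrix_mult_mat_commute)
  with pCons show ?case
    by (simp add: poly_mat_pCons mat_mult matrix_add_ldistrib)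
qed

lemma poly_mat_commute: "M ** poly_mat M p = poly_mat M p ** M"
proof (induction p)
  case (pCons a p)
  have "M ** (M ** poly_mat M p) = M ** poly_mat M p ** M"
    by (metis pCons(2) matrix_mul_assoc)
  then show ?case
    by (simp add: poly_mat_pCons matrix_add_ldistrib matrix_mult_add_left matrix_mult_mat_commute)
qed (simp add: matrix_mult_zero_right)

text \<open>Splitting X p as (X - c) p + c p reduces the product to the additive rules and to
  multiplication by X. The new factor is put on the right, which is legitimate since
  \<open>poly_mat M p\<close> commutes with \<open>M\<close>.\<close>

lemma poly_mat_linear_factor: "poly_mat M ([:-c, 1:] * p) = poly_mat M p ** (M - mat c)"
proof -
  have "pCons 0 p = [:-c, 1:] * p + smult c p"
    by simp
  then have "poly_mat M (pCons 0 p) = poly_mat M ([:-c, 1:] * p) + mat c ** poly_mat M p"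
    by (metis poly_mat_add poly_mat_smult)
  then show ?thesis
    by (simp add: poly_mat_pCons matrix_mult_diff_right poly_mat_commute matrix_mult_mat_commute
        eq_diff_eq)
qed

lemma poly_mat_sum: "poly_mat M (sum f S) = (\<Sum>x\<in>S. poly_mat M (f x))"
  by (induction S rule: infinite_finite_induct) (simp_all add: poly_mat_add)

text \<open>The space of matrices has finite real dimension \<open>N\<close>, so the
  \<open>N + 1\<close> powers of \<open>M\<close> with exponents 0 to \<open>N\<close> are linearly
  dependent.\<close>

lemma annihilating_poly_exists:
  fixes M :: "complex^'n^'n"
  shows "\<exists>p. p \<noteq> 0 \<and> poly_mat M p = 0"
proof -
  define N where "N = DIM(complex^'n^'n)"
  define pw where "pw k = poly_mat M (monom 1 k)" for k
  have diff: "poly_mat M (p - q) = poly_mat M p - poly_mat M q" for p q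
    using poly_mat_add[of M "p - q" q] by simp
  show ?thesis
  \<comment> \<open>Dependence is a property of a set and so does not see repeated powers. If two
    powers coincide, the difference of their monomials already annihilates \<open>M\<close>.\<close>
  proof (cases "inj_on pw {..N}")
    case False
    then obtain i j where "i \<noteq> j" "pw i = pw j"
      by (auto simp: inj_on_def)
    then show ?thesis
      by (intro exI[of _ "monom 1 i - monom 1 j"])
        (auto simp: diff pw_def poly_eq_iff coeff_monom)
  next
    case True
    have "card (pw ` {..N}) = Suc N"
      using True by (simp add: card_image)
    then have "dependent (pw ` {..N})"
      using independent_bound[of "pw ` {..N}"] unfolding N_def by auto
    then obtain u where u: "\<exists>v\<in>pw ` {..N}. u v \<noteq> 0" "(\<Sum>v\<in>pw ` {..N}. u v *\<^sub>R v) = 0"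
      by (subst (asm) real_vector.dependent_finite) auto
    \<comment> \<open>The real dependence coefficients are read as complex ones; injectivity of
      \<open>pw\<close> turns the sum over the set of powers into a sum over exponents.\<close>
    define p where "p = (\<Sum>k\<le>N. monom (complex_of_real (u (pw k))) k)"
    have "poly_mat M (monom c k) = mat c ** pw k" for c k
      unfolding pw_def poly_mat_smult[symmetric] by (simp add: smult_monom)
    then have "poly_mat M p = (\<Sum>k\<le>N. u (pw k) *\<^sub>R pw k)"
      by (simp add: p_def poly_mat_sum mat_of_real_mult)
    also have "\<dots> = 0"
      using u(2) sum.reindex[OF True, of "\<lambda>v. u v *\<^sub>R v"] by simp
    finally have "poly_mat M p = 0" .
    moreover obtain k where "k \<le> N" "u (pw k) \<noteq> 0"
      using u(1) by auto
    then have "coeff p k \<noteq> 0"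
      by (simp add: p_def coeff_sum coeff_monom)
    then have "p \<noteq> 0"
      by auto
    ultimately show ?thesis
      by auto
  qed
qed

text \<open>The linear factors of an annihilating polynomial are peeled off one at a time.\<close>
lemma annihilator_induct:
  fixes M :: "complex^'n^'n"
  assumes zero: "R 0"
    and factor: "\<And>G c. G ** M = M ** G \<Longrightarrow> R (G ** (M - mat c)) \<Longrightarrow> R G"
  shows "R (mat 1)"
proof -
  have descend: "R (poly_mat M (prod_mset (image_mset (\<lambda>c. [:-c, 1:]) S))) \<Longrightarrow> R (mat 1)" for S
  proof (induction S)
    case empty
    then show ?case
      by (simp add: poly_mat_pCons one_pCons matrix_mult_zero_right)
  next
    case (add c S)
    then show ?case
      using factor[OF poly_mat_commute[symmetric], of "\<Prod>x\<in>#S. [:-x, 1:]" c]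
      by (simp add: poly_mat_linear_factor del: mult_pCons_left)
  qed
  \<comment> \<open>Over the complex numbers the annihilator splits into linear factors; dividing by
    its leading coefficient shows that the bare product of these factors annihilates
    \<open>M\<close>.\<close>
  obtain p where p: "p \<noteq> 0" "poly_mat M p = 0"
    using annihilating_poly_exists by blast
  obtain S where S: "p = smult (lead_coeff p) (\<Prod>x\<in>#S. [:-x, 1:])"
    using alg_closed_imp_factorization[OF p(1)] by blast
  then have "(\<Prod>x\<in>#S. [:-x, 1:]) = smult (inverse (lead_coeff p)) p"
    using p(1) by (metis leading_coeff_0_iff left_inverse smult_1_left smult_smult)
  then have "poly_mat M (\<Prod>x\<in>#S. [:-x, 1:]) = 0"
    using p(2) by (simp add: poly_mat_smult matrix_mult_zero_right)
  with descend[of S] zero show ?thesis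
    by simp
qed

lemma matrix_vector_zero_left [simp]: "(0 :: complex^'m^'n) *v x = 0"
  by (simp add: matrix_vector_mult_def vec_eq_iff)

lemma matrix_vector_scaleR: "M *v (r *\<^sub>R x) = r *\<^sub>R (M *v x)"
  for M :: "complex^'m^'n"
  by (rule linear_scale[OF matrix_vector_mul_linear])

lemma norm_vector_smult: "norm (c *s x) = cmod c * norm x"
  for x :: "complex^'n"
  by (simp add: norm_vec_def norm_mult L2_set_right_distrib)

lemma invertible_mult_vector_eq:
  fixes M :: "complex^'n^'n"
  assumes "invertible M"
  shows "\<exists>N. (\<forall>x. N *v (M *v x) = x) \<and> (\<forall>x. M *v (N *v x) = x)"
  using assms unfolding invertible_def by (metis matrix_vector_mul_assoc matrix_vector_mul_lid)

section \<open>Square-summable sequences\<close>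

definition l2 :: "(nat \<Rightarrow> 'a::real_normed_vector) \<Rightarrow> bool" where
  "l2 y \<longleftrightarrow> summable (\<lambda>t. (norm (y t))\<^sup>2)"

definition energy :: "(nat \<Rightarrow> 'a::real_normed_vector) \<Rightarrow> real" where
  "energy y = (\<Sum>t. (norm (y t))\<^sup>2)"

text \<open>For complex vectors \<open>\<bullet>\<close> is the real part of the Hermitian product,
  so this form is bilinear, and orthogonality is meant, over the reals.\<close>

definition ip :: "(nat \<Rightarrow> 'a::real_inner) \<Rightarrow> (nat \<Rightarrow> 'a) \<Rightarrow> real" where
  "ip y z = (\<Sum>t. y t \<bullet> z t)"

lemma l2_le:
  assumes "l2 z" "\<And>t. norm (y t) \<le> c * norm (z t)"
  shows "l2 y"
  unfolding l2_def
proof (rule summable_comparison_test')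
  show "summable (\<lambda>t. c\<^sup>2 * (norm (z t))\<^sup>2)"
    using assms(1) by (simp add: l2_def summable_mult)
  show "norm ((norm (y t))\<^sup>2) \<le> c\<^sup>2 * (norm (z t))\<^sup>2" for t
    using power_mono[OF assms(2)[of t] norm_ge_zero, of 2] by (simp add: power_mult_distrib)
qed

lemma l2_zero [simp]: "l2 (\<lambda>t. 0)"
  by (simp add: l2_def)

lemma l2_add:
  assumes "l2 y" "l2 z"
  shows "l2 (\<lambda>t. y t + z t)"
  unfolding l2_def
proof (rule summable_comparison_test')
  show "summable (\<lambda>t. 2 * (norm (y t))\<^sup>2 + 2 * (norm (z t))\<^sup>2)"
    using assms by (simp add: l2_def summable_mult summable_add)
  show "norm ((norm (y t + z t))\<^sup>2) \<le> 2 * (norm (y t))\<^sup>2 + 2 * (norm (z t))\<^sup>2" for t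
  proof -
    have "(norm (y t + z t))\<^sup>2 \<le> (norm (y t) + norm (z t))\<^sup>2"
      by (simp add: norm_triangle_ineq power_mono)
    also have "\<dots> \<le> 2 * (norm (y t))\<^sup>2 + 2 * (norm (z t))\<^sup>2"
      using sum_squares_bound[of "norm (y t)" "norm (z t)"] by (simp add: power2_sum)
    finally show ?thesis by simp
  qed
qed

lemma l2_bounded_linear:
  assumes "bounded_linear f" "l2 y"
  shows "l2 (\<lambda>t. f (y t))"
proof -
  obtain K where "\<And>x. norm (f x) \<le> K * norm x"
    using bounded_linear.bounded[OF assms(1)] by (metis mult.commute)
  then show ?thesis by (rule l2_le[OF assms(2)])
qed

lemma l2_scaleR: "l2 y \<Longrightarrow> l2 (\<lambda>t. r *\<^sub>R y t)"
  by (rule l2_bounded_linear[OF bounded_linear_scaleR_right])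

lemma l2_diff: "l2 y \<Longrightarrow> l2 z \<Longrightarrow> l2 (\<lambda>t. y t - z t)"
  using l2_add[of y "\<lambda>t. (-1) *\<^sub>R z t"] l2_scaleR[of z "-1"] by simp

lemma l2_shift: "l2 y \<Longrightarrow> l2 (\<lambda>t. y (t + k))"
  unfolding l2_def by (subst summable_iff_shift)

lemma l2_Suc_iff: "l2 (\<lambda>t. y (Suc t)) \<longleftrightarrow> l2 y"
  unfolding l2_def using summable_Suc_iff[of "\<lambda>t. (norm (y t))\<^sup>2"] by simp

lemma l2_tendsto_zero:
  assumes "l2 y"
  shows "y \<longlonglongrightarrow> 0"
proof -
  have "(\<lambda>t. (norm (y t))\<^sup>2) \<longlonglongrightarrow> 0"
    using assms unfolding l2_def by (rule summable_LIMSEQ_zero)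
  then have "(\<lambda>t. sqrt ((norm (y t))\<^sup>2)) \<longlonglongrightarrow> sqrt 0"
    by (rule tendsto_real_sqrt)
  then show ?thesis
    by (simp add: tendsto_norm_zero_iff)
qed

lemma energy_nonneg: "l2 y \<Longrightarrow> 0 \<le> energy y"
  unfolding energy_def l2_def by (rule suminf_nonneg) auto

section \<open>Inner products and energies of square-summable sequences\<close>

lemma summable_inner:
  assumes "l2 y" "l2 z"
  shows "summable (\<lambda>t. y t \<bullet> z t)"
proof (rule summable_comparison_test')
  show "summable (\<lambda>t. (norm (y t))\<^sup>2 + (norm (z t))\<^sup>2)"
    using assms by (simp add: l2_def summable_add)
  show "norm (y t \<bullet> z t) \<le> (norm (y t))\<^sup>2 + (norm (z t))\<^sup>2" for t
  proof -
    have "\<bar>y t \<bullet> z t\<bar> \<le> norm (y t) * norm (z t)"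
      by (rule Cauchy_Schwarz_ineq2)
    also have "\<dots> \<le> (norm (y t))\<^sup>2 + (norm (z t))\<^sup>2"
      using sum_squares_bound[of "norm (y t)" "norm (z t)"]
        mult_nonneg_nonneg[OF norm_ge_zero[of "y t"] norm_ge_zero[of "z t"]]
      by linarith
    finally show ?thesis by simp
  qed
qed

lemma ip_add_right:
  "l2 w \<Longrightarrow> l2 y \<Longrightarrow> l2 z \<Longrightarrow> ip w (\<lambda>t. y t + z t) = ip w y + ip w z"
  unfolding ip_def by (simp add: inner_add_right summable_inner suminf_add)

lemma ip_add_left:
  "l2 w \<Longrightarrow> l2 y \<Longrightarrow> l2 z \<Longrightarrow> ip (\<lambda>t. y t + z t) w = ip y w + ip z w"
  unfolding ip_def by (simp add: inner_add_left summable_inner suminf_add)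

lemma ip_scaleR_right:
  "l2 w \<Longrightarrow> l2 y \<Longrightarrow> ip w (\<lambda>t. r *\<^sub>R y t) = r * ip w y"
  unfolding ip_def by (simp add: summable_inner suminf_mult)

lemma ip_Suc:
  assumes "l2 y" "l2 z"
  shows "ip y z = y 0 \<bullet> z 0 + ip (\<lambda>t. y (Suc t)) (\<lambda>t. z (Suc t))"
  unfolding ip_def using suminf_split_head[OF summable_inner[OF assms]] by simp

lemma energy_add_scaleR:
  assumes "l2 y" "l2 z"
  shows "energy (\<lambda>t. y t + r *\<^sub>R z t) = energy y + 2 * r * ip y z + r\<^sup>2 * energy z"
proof -
  have "(norm (y t + r *\<^sub>R z t))\<^sup>2 = (norm (y t))\<^sup>2 + 2 * r * (y t \<bullet> z t) + r\<^sup>2 * (norm (z t))\<^sup>2" for t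
    by (simp add: power2_norm_eq_inner inner_simps inner_commute)
      (simp add: power2_eq_square algebra_simps)
  moreover have "(\<lambda>t. (norm (y t))\<^sup>2 + 2 * r * (y t \<bullet> z t) + r\<^sup>2 * (norm (z t))\<^sup>2)
      sums (energy y + 2 * r * ip y z + r\<^sup>2 * energy z)"
    using assms summable_inner[OF assms] unfolding energy_def ip_def l2_def
    by (intro sums_add sums_mult summable_sums)
  ultimately show ?thesis
    unfolding energy_def[of "\<lambda>t. y t + r *\<^sub>R z t"] by (simp add: sums_iff)
qed

text \<open>A real parabola that is never negative has nonpositive discriminant; the degenerate case
  \<open>a = 0\<close> is included so that sequences of zero energy are covered.\<close>

lemma quadratic_nonneg_discriminant:
  fixes a b c :: real
  assumes "\<And>s. 0 \<le> c + 2 * s * b + s\<^sup>2 * a" "0 \<le> a"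
  shows "b\<^sup>2 \<le> a * c"
proof (cases "a = 0")
  case True
  have "b = 0"
  proof (rule ccontr)
    assume "b \<noteq> 0"
    \<comment> \<open>With \<open>a = 0\<close> this value of \<open>s\<close> makes the expression
      equal to -1.\<close>
    then show False
      using assms(1)[of "- (c + 1) / (2 * b)"] True by (simp add: field_simps)
  qed
  with True show ?thesis by simp
next
  case False
  then have "a > 0" using assms(2) by simp
  \<comment> \<open>The parabola attains its minimum at \<open>- b / a\<close>.\<close>
  have "0 \<le> c - b\<^sup>2 / a"
    using assms(1)[of "- b / a"] False by (simp add: field_simps power2_eq_square)
  then show ?thesis
    using \<open>a > 0\<close> by (simp add: field_simps)
qed

lemma ip_Cauchy_Schwarz:
  assumes "l2 y" "l2 z"
  shows "(ip y z)\<^sup>2 \<le> energy z * energy y"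
proof (rule quadratic_nonneg_discriminant)
  show "0 \<le> energy y + 2 * s * ip y z + s\<^sup>2 * energy z" for s
    using energy_nonneg[OF l2_add[OF assms(1) l2_scaleR[OF assms(2), of s]]]
    by (simp add: energy_add_scaleR assms)
qed (simp add: energy_nonneg assms)

text \<open>The energy of the tail of \<open>y\<close> tends to 0, and Cauchy-Schwarz transfers this
  to the inner product.\<close>

lemma ip_shift_tendsto_zero:
  assumes "l2 y" "l2 z"
  shows "(\<lambda>k. ip (\<lambda>t. y (t + k)) z) \<longlonglongrightarrow> 0"
proof -
  have "(\<lambda>k. energy (\<lambda>t. y (t + k))) \<longlonglongrightarrow> 0"
  proof -
    have "(\<lambda>k. energy y - (\<Sum>t<k. (norm (y t))\<^sup>2)) \<longlonglongrightarrow> energy y - energy y"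
      using assms(1) unfolding l2_def energy_def
      by (intro tendsto_diff tendsto_const summable_LIMSEQ)
    moreover have "energy (\<lambda>t. y (t + k)) = energy y - (\<Sum>t<k. (norm (y t))\<^sup>2)" for k
      using assms(1) unfolding l2_def energy_def by (rule suminf_minus_initial_segment)
    ultimately show ?thesis by simp
  qed
  then have lim: "(\<lambda>k. energy z * energy (\<lambda>t. y (t + k))) \<longlonglongrightarrow> 0"
    by (rule tendsto_mult_right_zero)
  have "(\<lambda>k. (ip (\<lambda>t. y (t + k)) z)\<^sup>2) \<longlonglongrightarrow> 0"
    by (rule tendsto_sandwich[OF _ _ tendsto_const lim])
      (auto intro!: always_eventually ip_Cauchy_Schwarz l2_shift assms)
  then show ?thesis
    using tendsto_real_sqrt[of "\<lambda>k. (ip (\<lambda>t. y (t + k)) z)\<^sup>2" 0]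
    by (simp add: tendsto_rabs_zero_iff)
qed

text \<open>Squaring the recursion by convexity keeps the factor \<open>r\<close> in front of the
  squared norm, so summation bounds the partial sums of the squares by \<open>r\<close> times
  themselves plus a constant.\<close>

lemma l2_contraction:
  fixes y :: "nat \<Rightarrow> 'a::real_normed_vector" and h :: "nat \<Rightarrow> 'b::real_normed_vector"
  assumes step: "\<And>t. norm (y (Suc t)) \<le> r * norm (y t) + norm (h t)"
    and r: "0 \<le> r" "r < 1" and h: "l2 h"
  shows "l2 y"
proof -
  define c where "c = inverse (1 - r)"
  have c: "c > 0" using r by (simp add: c_def)
  have sq: "(norm (y (Suc t)))\<^sup>2 \<le> r * (norm (y t))\<^sup>2 + c * (norm (h t))\<^sup>2" for t
  proof -
    define f g where "f = norm (y t)" and "g = norm (h t)"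
    \<comment> \<open>As \<open>k\<close> is \<open>g / (1 - r)\<close>, the bound
      \<open>r * f + g\<close> is the convex combination of \<open>f\<close> and \<open>k\<close>
      with weights \<open>r\<close> and \<open>1 - r\<close>; the term dropped below is the defect
      in Jensen's inequality for the square.\<close>
    define k where "k = c * g"
    have g: "g = (1 - r) * k"
      using r by (simp add: c_def k_def)
    have "(norm (y (Suc t)))\<^sup>2 \<le> (r * f + g)\<^sup>2"
      using step by (simp add: f_def g_def power_mono)
    also have "\<dots> = r * f\<^sup>2 + k * g - r * (1 - r) * (f - k)\<^sup>2"
      unfolding g by (simp add: algebra_simps power2_eq_square)
    also have "\<dots> \<le> r * f\<^sup>2 + c * g\<^sup>2"
      using r by (simp add: k_def power2_eq_square)
    finally show ?thesis by (simp add: f_def g_def)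
  qed
  have "(\<Sum>t<N. (norm (y t))\<^sup>2) \<le> ((norm (y 0))\<^sup>2 + c * energy h) * c" for N
  proof -
    let ?S = "\<Sum>t<N. (norm (y t))\<^sup>2"
    have "?S \<le> (\<Sum>t<Suc N. (norm (y t))\<^sup>2)"
      by simp
    also have "\<dots> = (norm (y 0))\<^sup>2 + (\<Sum>t<N. (norm (y (Suc t)))\<^sup>2)"
      by (rule sum.lessThan_Suc_shift)
    also have "(\<Sum>t<N. (norm (y (Suc t)))\<^sup>2) \<le> (\<Sum>t<N. r * (norm (y t))\<^sup>2 + c * (norm (h t))\<^sup>2)"
      by (intro sum_mono sq)
    also have "\<dots> = r * ?S + c * (\<Sum>t<N. (norm (h t))\<^sup>2)"
      by (simp add: sum.distrib sum_distrib_left)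
    also have "(\<Sum>t<N. (norm (h t))\<^sup>2) \<le> energy h"
      using h unfolding l2_def energy_def by (intro sum_le_suminf) auto
    finally have "(1 - r) * ?S \<le> (norm (y 0))\<^sup>2 + c * energy h"
      using c by (simp add: algebra_simps)
    then show ?thesis
      using r unfolding c_def divide_inverse[symmetric]
      by (simp add: pos_le_divide_eq mult.commute)
  qed
  then show ?thesis
    unfolding l2_def by (intro summableI_nonneg_bounded) auto
qed

text \<open>Completeness with a rate: the pointwise limit exists, and the bound on finite partial
  sums survives letting \<open>j\<close>, and then the number of terms, tend to infinity.\<close>

lemma l2_limit:
  fixes Y :: "nat \<Rightarrow> nat \<Rightarrow> 'a::{real_normed_vector, complete_space}"
  assumes l2: "\<And>k. l2 (Y k)"
    and cauchy: "\<And>k j. energy (\<lambda>t. Y k t - Y j t) \<le> e k + e j"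
    and e: "e \<longlonglongrightarrow> 0"
  obtains z where "l2 z" "\<And>k. energy (\<lambda>t. Y k t - z t) \<le> e k"
proof -
  have l2d: "l2 (\<lambda>t. Y k t - Y j t)" for k j
    by (intro l2_diff l2)
  have part: "(\<Sum>t<N. (norm (Y k t - Y j t))\<^sup>2) \<le> e k + e j" for N k j
    using l2d[of k j] cauchy[of k j] unfolding l2_def energy_def
    by (intro order_trans[OF sum_le_suminf]) auto
  have "Cauchy (\<lambda>k. Y k t)" for t
  proof (rule metric_CauchyI)
    fix d :: real assume "d > 0"
    then have "d\<^sup>2 / 2 > 0" by simp
    from order_tendstoD(2)[OF e this] obtain K where K: "\<And>k. k \<ge> K \<Longrightarrow> e k < d\<^sup>2 / 2"
      by (auto simp: eventually_sequentially)
    have "dist (Y k t) (Y j t) < d" if "k \<ge> K" "j \<ge> K" for k j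
    proof -
      have "(norm (Y k t - Y j t))\<^sup>2 \<le> (\<Sum>t<Suc t. (norm (Y k t - Y j t))\<^sup>2)"
        by (simp add: sum_nonneg)
      also have "\<dots> < d\<^sup>2"
        using part[of k j "Suc t"] K[OF that(1)] K[OF that(2)] by simp
      finally show ?thesis
        using \<open>d > 0\<close> by (simp add: dist_norm power_less_imp_less_base)
    qed
    then show "\<exists>K. \<forall>k\<ge>K. \<forall>j\<ge>K. dist (Y k t) (Y j t) < d" by blast
  qed
  then have "\<exists>z. (\<lambda>k. Y k t) \<longlonglongrightarrow> z" for t
    by (simp add: Cauchy_convergent_iff convergent_def)
  then obtain z where z: "\<And>t. (\<lambda>k. Y k t) \<longlonglongrightarrow> z t" by metis
  have lim: "(\<Sum>t<N. (norm (Y k t - z t))\<^sup>2) \<le> e k" for k N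
  proof (rule tendsto_le[OF sequentially_bot])
    show "(\<lambda>j. e k + e j) \<longlonglongrightarrow> e k"
      using tendsto_add[OF tendsto_const e] by simp
    show "(\<lambda>j. \<Sum>t<N. (norm (Y k t - Y j t))\<^sup>2) \<longlonglongrightarrow> (\<Sum>t<N. (norm (Y k t - z t))\<^sup>2)"
      by (intro tendsto_intros z)
  qed (simp add: part)
  then have l2z: "l2 (\<lambda>t. Y k t - z t)" for k
    unfolding l2_def by (intro summableI_nonneg_bounded) auto
  show thesis
  proof
    show "l2 z"
      using l2_diff[OF l2 l2z, of 0 0] by simp
    show "energy (\<lambda>t. Y k t - z t) \<le> e k" for k
      unfolding energy_def using l2z[of k] lim[of k] by (intro suminf_le_const) (auto simp: l2_def)
  qed
qed

text \<open>Projection of the origin onto the closure of an affine set of square-summable sequences.\<close>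
lemma minimal_energy_limit:
  fixes S :: "(nat \<Rightarrow> 'a::{real_inner, complete_space}) set"
  assumes ne: "S \<noteq> {}" and l2: "\<And>y. y \<in> S \<Longrightarrow> l2 y"
    and aff: "\<And>y z w r. y \<in> S \<Longrightarrow> z \<in> S \<Longrightarrow> w \<in> S \<Longrightarrow> (\<lambda>t. y t + r *\<^sub>R (z t - w t)) \<in> S"
  shows "\<exists>Y z. (\<forall>k. Y k \<in> S) \<and> l2 z \<and> (\<lambda>k. energy (\<lambda>t. Y k t - z t)) \<longlonglongrightarrow> 0
      \<and> (\<forall>y\<in>S. \<forall>w\<in>S. ip z (\<lambda>t. y t - w t) = 0)"
proof -
  define d where "d = Inf (energy ` S)"
  have bdd: "bdd_below (energy ` S)"
    using energy_nonneg l2 by (auto intro!: bdd_belowI[of _ 0])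
  have d_le: "d \<le> energy y" if "y \<in> S" for y
    unfolding d_def using that bdd by (intro cInf_lower) auto
  define e where "e k = inverse (real (Suc k))" for k
  have e_pos: "e k > 0" for k by (simp add: e_def)
  have e0: "e \<longlonglongrightarrow> 0"
    unfolding e_def by (rule LIMSEQ_inverse_real_of_nat)
  have "\<exists>y\<in>S. energy y < d + e k" for k
    using cInf_lessD[of "energy ` S" "d + e k"] ne e_pos[of k] by (auto simp: d_def)
  then obtain Y where Y: "\<And>k. Y k \<in> S" "\<And>k. energy (Y k) < d + e k" by metis
  have cauchy: "energy (\<lambda>t. Y k t - Y j t) \<le> 2 * e k + 2 * e j" for k j
  proof -
    \<comment> \<open>The midpoint of two near-minimisers has energy at least \<open>d\<close>; by
      the parallelogram law the energy of their difference is at most twice the sum of their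
      excesses over \<open>d\<close>.\<close>
    have mid: "(\<lambda>t. Y k t + (1/2) *\<^sub>R (Y j t - Y k t)) \<in> S"
      by (intro aff Y)
    have l2s: "l2 (Y k)" "l2 (Y j)" "l2 (\<lambda>t. Y j t - Y k t)"
      by (intro l2_diff l2 Y)+
    have "d \<le> energy (Y k) + ip (Y k) (\<lambda>t. Y j t - Y k t) + energy (\<lambda>t. Y j t - Y k t) / 4"
      using d_le[OF mid] l2s by (simp add: energy_add_scaleR power2_eq_square)
    moreover have "energy (Y j) = energy (Y k) + 2 * ip (Y k) (\<lambda>t. Y j t - Y k t)
        + energy (\<lambda>t. Y j t - Y k t)"
      using energy_add_scaleR[OF l2s(1,3), of 1] by simp
    moreover have "energy (\<lambda>t. Y k t - Y j t) = energy (\<lambda>t. Y j t - Y k t)"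
      by (simp add: energy_def norm_minus_commute)
    ultimately show ?thesis
      using Y(2)[of k] Y(2)[of j] by simp
  qed
  have "(\<lambda>k. 2 * e k) \<longlonglongrightarrow> 0"
    using e0 by (rule tendsto_mult_right_zero)
  then obtain z where z: "l2 z" "\<And>k. energy (\<lambda>t. Y k t - z t) \<le> 2 * e k"
    using l2_limit[of Y "\<lambda>k. 2 * e k"] cauchy l2 Y(1) by metis
  show ?thesis
  proof (intro exI conjI allI ballI)
    show "(\<lambda>k. energy (\<lambda>t. Y k t - z t)) \<longlonglongrightarrow> 0"
      using energy_nonneg[OF l2_diff[OF l2[OF Y(1)] z(1)]] z(2)
      by (intro tendsto_sandwich[OF _ _ tendsto_const \<open>(\<lambda>k. 2 * e k) \<longlonglongrightarrow> 0\<close>]) auto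
    show "ip z (\<lambda>t. y t - w t) = 0" if "y \<in> S" "w \<in> S" for y w
    proof -
      define h where "h = (\<lambda>t. y t - w t)"
      have h: "l2 h" unfolding h_def by (intro l2_diff l2 that)
      have 1: "(ip (Y k) h)\<^sup>2 \<le> energy h * e k" for k
      \<comment> \<open>Moving \<open>Y k\<close> along \<open>h\<close> cannot push the energy
        below \<open>d\<close>, hence lowers it by less than \<open>e k\<close>; the discriminant of
        this quadratic in \<open>s\<close> bounds the inner product.\<close>
      proof (rule quadratic_nonneg_discriminant)
        fix s
        have "(\<lambda>t. Y k t + s *\<^sub>R h t) \<in> S"
          unfolding h_def by (intro aff Y that)
        then have "d \<le> energy (Y k) + 2 * s * ip (Y k) h + s\<^sup>2 * energy h"
          using d_le l2 h Y(1) by (simp flip: energy_add_scaleR)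
        then show "0 \<le> e k + 2 * s * ip (Y k) h + s\<^sup>2 * energy h"
          using Y(2)[of k] by simp
      qed (simp add: energy_nonneg h)
      have 2: "(ip (\<lambda>t. Y k t - z t) h)\<^sup>2 \<le> energy h * (2 * e k)" for k
        using ip_Cauchy_Schwarz[OF l2_diff[OF l2[OF Y(1)] z(1)] h, of k]
          mult_left_mono[OF z(2) energy_nonneg[OF h], of k] by linarith
      have split: "ip (Y k) h = ip (\<lambda>t. Y k t - z t) h + ip z h" for k
        using ip_add_left[OF h l2_diff[OF l2[OF Y(1)] z(1)] z(1), of k] by simp
      \<comment> \<open>The square of a difference is at most twice the sum of the squares, and the
        two bounds above carry the constants 1 and 2, which gives 6.\<close>
      have "(ip z h)\<^sup>2 \<le> 6 * energy h * e k" for k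
        using sum_squares_bound[of "ip (Y k) h" "- ip (\<lambda>t. Y k t - z t) h"] 1[of k] 2[of k]
          split[of k] by (simp add: power2_eq_square algebra_simps)
      moreover have "(\<lambda>k. 6 * energy h * e k) \<longlonglongrightarrow> 0"
        using e0 by (rule tendsto_mult_right_zero)
      ultimately have "(ip z h)\<^sup>2 \<le> 0"
        by (intro tendsto_lowerbound) auto
      then show ?thesis by (simp add: h_def)
    qed
  qed (fact Y(1), fact z(1))
qed

section \<open>Linear recursions\<close>

text \<open>Linear factors \<open>F - mat c\<close> are removed one by one. If
  \<open>cmod c < 1\<close>, then \<open>G *v x t\<close> obeys a scalar contraction driven by a
  square-summable input; otherwise \<open>mat c - F\<close> is invertible, and
  \<open>G *v x t\<close> is recovered from that input.\<close>

lemma stable_trajectory_l2: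
  fixes F :: "complex^'n^'n"
  assumes stable: "\<And>z. cmod z \<ge> 1 \<Longrightarrow> invertible (mat z - F)"
    and x: "\<And>t. x (Suc t) = F *v x t"
  shows "l2 x"
proof -
  have "l2 (\<lambda>t. mat 1 *v x t)"
  proof (rule annihilator_induct[of "\<lambda>G. l2 (\<lambda>t. G *v x t)" F])
    fix G c
    assume comm: "G ** F = F ** G" and IH: "l2 (\<lambda>t. G ** (F - mat c) *v x t)"
    have factor: "G ** (F - mat c) *v x t = F *v (G *v x t) - c *s (G *v x t)" for t
      by (simp add: matrix_mult_diff_right comm matrix_mult_mat_commute matrix_vector_mult_diff_rdistrib
          mat_mult_vector flip: matrix_vector_mul_assoc)
    show "l2 (\<lambda>t. G *v x t)"
    proof (cases "cmod c < 1")
      case True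
      have "G *v x (Suc t) = F *v (G *v x t)" for t
        by (simp add: x matrix_vector_mul_assoc comm)
      then have "G *v x (Suc t) = c *s (G *v x t) + G ** (F - mat c) *v x t" for t
        by (simp add: factor)
      then have "norm (G *v x (Suc t)) \<le> cmod c * norm (G *v x t) + norm (G ** (F - mat c) *v x t)" for t
        by (metis norm_triangle_ineq norm_vector_smult)
      then show ?thesis
        by (rule l2_contraction[OF _ norm_ge_zero True IH])
    next
      case False
      then have "invertible (mat c - F)"
        using stable by simp
      then obtain N where N: "\<And>y. N *v ((mat c - F) *v y) = y"
        using invertible_mult_vector_eq by blast
      have eq: "G *v x t = (-1) *\<^sub>R (N *v (G ** (F - mat c) *v x t))" for t
        using N[of "G *v x t"] unfolding factor
        by (simp add: matrix_vector_mult_diff_rdistrib mat_mult_vector matrix_vector_mult_diff_distrib)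
      show ?thesis
        unfolding eq by (intro l2_scaleR l2_bounded_linear[OF matrix_vector_mul_bounded_linear] IH)
    qed
  qed simp
  then show ?thesis by simp
qed

text \<open>Again linear factors are removed. For \<open>cmod c > 1\<close> the factor
  \<open>M - mat c\<close> is invertible and can be cancelled. Otherwise \<open>M\<close> acts under
  \<open>p\<close> on the range of \<open>G\<close> as multiplication by \<open>c\<close>; the
  powers of \<open>c\<close> stay bounded, so the decay of \<open>p\<close> forces 0, even for
  \<open>c\<close> on the unit circle.\<close>

lemma costate_zero:
  fixes M :: "complex^'n^'n" and p :: "nat \<Rightarrow> complex^'n \<Rightarrow> real"
  assumes linear: "\<And>t. linear (p t)"
    and step: "\<And>t \<xi>. p t \<xi> = p (Suc t) (M *v \<xi>)"
    and lim: "\<And>\<xi>. (\<lambda>t. p t \<xi>) \<longlonglongrightarrow> 0"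
    and inv: "\<And>c. cmod c > 1 \<Longrightarrow> invertible (mat c - M)"
  shows "p t \<xi> = 0"
proof -
  have "\<forall>t \<xi>. p t (mat 1 *v \<xi>) = 0"
  proof (rule annihilator_induct[of "\<lambda>G. \<forall>t \<xi>. p t (G *v \<xi>) = 0" M])
    show "\<forall>t \<xi>. p t (0 *v \<xi>) = 0"
      using linear linear_0 by (metis matrix_vector_zero_left)
  next
    fix G c
    assume comm: "G ** M = M ** G" and IH: "\<forall>t \<xi>. p t (G ** (M - mat c) *v \<xi>) = 0"
    show "\<forall>t \<xi>. p t (G *v \<xi>) = 0"
    proof (cases "cmod c > 1")
      case True
      obtain N where N: "\<And>y. (mat c - M) *v (N *v y) = y"
        using inv[OF True] invertible_mult_vector_eq by blast
      have "G *v \<xi> = - (G ** (M - mat c) *v (N *v \<xi>))" for \<xi>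
      proof -
        have "G *v \<xi> = G *v ((mat c - M) *v (N *v \<xi>))"
          by (simp add: N)
        also have "\<dots> = - (G ** (M - mat c) *v (N *v \<xi>))"
          by (simp add: matrix_vector_mult_diff_rdistrib matrix_mult_diff_right
              matrix_vector_mult_diff_distrib flip: matrix_vector_mul_assoc)
        finally show ?thesis .
      qed
      then show ?thesis
        using IH by (simp add: linear_neg[OF linear])
    next
      case False
      have step': "p t (G *v \<xi>) = p (Suc t) (G *v (c *s \<xi>))" for t \<xi>
      proof -
        have "0 = p (Suc t) (G *v (M *v \<xi>) - G *v (c *s \<xi>))"
          using IH[rule_format, of "Suc t" \<xi>]
          by (simp add: matrix_mult_diff_right matrix_vector_mult_diff_rdistrib
              mat_mult_vector flip: matrix_vector_mul_assoc)
        then have "p (Suc t) (G *v (M *v \<xi>)) = p (Suc t) (G *v (c *s \<xi>))"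
          by (simp add: linear_diff[OF linear])
        then show ?thesis
          using step[of t "G *v \<xi>"] by (simp add: matrix_vector_mul_assoc comm)
      qed
      have iter: "p t (G *v \<xi>) = p (k + t) (G *v (c ^ k *s \<xi>))" for t k \<xi>
      proof (induction k)
        case (Suc k)
        then show ?case
          using step'[of "k + t" "c ^ k *s \<xi>"] by (simp add: mult.commute)
      qed simp
      show ?thesis
      proof (intro allI)
        fix t \<xi>
        define v where "v = G *v \<xi>"
        \<comment> \<open>Each functional is linear only over the reals, so multiplication by the
          complex number \<open>c ^ k\<close> is resolved into real multiples of \<open>v\<close>
          and \<open>\<i> *s v\<close>.\<close>
        have bound: "norm (p t v) \<le> \<bar>p (k + t) v\<bar> + \<bar>p (k + t) (\<i> *s v)\<bar>" for k
        proof -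
          have "cmod (c ^ k) \<le> 1"
            using False by (simp add: norm_power power_le_one)
          then have le: "\<bar>Re (c ^ k)\<bar> \<le> 1" "\<bar>Im (c ^ k)\<bar> \<le> 1"
            using abs_Re_le_cmod abs_Im_le_cmod order_trans by blast+
          have "c ^ k *s v = Re (c ^ k) *\<^sub>R v + Im (c ^ k) *\<^sub>R (\<i> *s v)"
            by (simp add: vec_eq_iff complex_eq_iff)
          then have "p t v = Re (c ^ k) * p (k + t) v + Im (c ^ k) * p (k + t) (\<i> *s v)"
            using iter[of t \<xi> k]
            by (simp add: v_def vec.scale linear_add[OF linear] linear_scale[OF linear])
          then have "norm (p t v) \<le> \<bar>Re (c ^ k)\<bar> * \<bar>p (k + t) v\<bar> + \<bar>Im (c ^ k)\<bar> * \<bar>p (k + t) (\<i> *s v)\<bar>"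
            by (simp add: abs_triangle_ineq flip: abs_mult)
          also have "\<dots> \<le> \<bar>p (k + t) v\<bar> + \<bar>p (k + t) (\<i> *s v)\<bar>"
            by (intro add_mono mult_left_le_one_le le) auto
          finally show ?thesis .
        qed
        have "(\<lambda>k. \<bar>p (k + t) v\<bar> + \<bar>p (k + t) (\<i> *s v)\<bar>) \<longlonglongrightarrow> \<bar>0\<bar> + \<bar>0\<bar>"
          by (intro tendsto_add tendsto_rabs LIMSEQ_ignore_initial_segment lim)
        then have "norm (p t v) \<le> \<bar>0\<bar> + \<bar>0\<bar>"
          using bound by (intro tendsto_lowerbound[OF _ always_eventually]) auto
        then show "p t (G *v \<xi>) = 0"
          by (simp add: v_def)
      qed
    qed
  qed
  then show ?thesis by simp
qed

section \<open>Feasible trajectories\<close>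

lemma feasible_iff:
  "feasible A B a x u \<longleftrightarrow>
    (\<forall>t. x (Suc t) = A *v x t + B *v u t) \<and> x 0 = a \<and> l2 x \<and> l2 u"
proof -
  have "summable (\<lambda>t. (norm (x t))\<^sup>2 + (norm (u t))\<^sup>2) \<longleftrightarrow> l2 x \<and> l2 u"
  proof safe
    assume s: "summable (\<lambda>t. (norm (x t))\<^sup>2 + (norm (u t))\<^sup>2)"
    show "l2 x" "l2 u"
      unfolding l2_def by (rule summable_comparison_test'[OF s]; simp)+
  qed (simp add: l2_def summable_add)
  then show ?thesis
    by (simp add: feasible_def)
qed

lemma feasible_add:
  "feasible A B a x u \<Longrightarrow> feasible A B b y v \<Longrightarrow>
    feasible A B (a + b) (\<lambda>t. x t + y t) (\<lambda>t. u t + v t)"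
  by (simp add: feasible_iff l2_add matrix_vector_right_distrib)

lemma feasible_scaleR:
  "feasible A B a x u \<Longrightarrow> feasible A B (r *\<^sub>R a) (\<lambda>t. r *\<^sub>R x t) (\<lambda>t. r *\<^sub>R u t)"
  by (simp add: feasible_iff l2_scaleR matrix_vector_scaleR scaleR_add_right)

lemma feasible_diff:
  "feasible A B a x u \<Longrightarrow> feasible A B b y v \<Longrightarrow>
    feasible A B (a - b) (\<lambda>t. x t - y t) (\<lambda>t. u t - v t)"
  using feasible_add[OF _ feasible_scaleR[of A B b y v "-1"]] by simp

text \<open>Prepending one step to a trajectory is what makes the dynamic programming recursion
  possible.\<close>

lemma feasible_cons:
  assumes "feasible A B (A *v \<xi> + B *v w) x u"
  shows "feasible A B \<xi> (case_nat \<xi> x) (case_nat w u)"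
  using assms l2_Suc_iff[of "case_nat \<xi> x"] l2_Suc_iff[of "case_nat w u"]
  by (auto simp: feasible_iff split: nat.split)

text \<open>The feedback \<open>K\<close> gives the closed loop \<open>A + B ** K\<close>, whose
  trajectories are square-summable, and hence so are the inputs.\<close>

lemma feasible_exists:
  fixes A :: "complex^'n^'n" and B :: "complex^'m^'n" and K :: "complex^'n^'m"
  assumes "\<And>z. cmod z \<ge> 1 \<Longrightarrow> invertible (mat z - A - B ** K)"
  shows "\<exists>x u. feasible A B a x u"
proof -
  define x where "x t = ((*v) (A + B ** K) ^^ t) a" for t
  have "l2 x"
    by (rule stable_trajectory_l2[of "A + B ** K"]) (use assms in \<open>auto simp: x_def diff_diff_eq\<close>)
  moreover from this have "l2 (\<lambda>t. K *v x t)"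
    by (rule l2_bounded_linear[OF matrix_vector_mul_bounded_linear])
  ultimately have "feasible A B a x (\<lambda>t. K *v x t)"
    by (simp add: feasible_iff x_def matrix_vector_mult_add_rdistrib matrix_vector_mul_assoc)
  then show ?thesis by blast
qed

section \<open>Outputs of the system\<close>

definition sys_output :: "complex^'n^'k \<Rightarrow> complex^'m^'k
    \<Rightarrow> (nat \<Rightarrow> complex^'n) \<Rightarrow> (nat \<Rightarrow> complex^'m) \<Rightarrow> nat \<Rightarrow> complex^'k" where
  "sys_output C D x u t = C *v x t + D *v u t"

lemma sys_output_add:
  "sys_output C D (\<lambda>t. x t + y t) (\<lambda>t. u t + v t) = (\<lambda>t. sys_output C D x u t + sys_output C D y v t)"
  by (simp add: sys_output_def fun_eq_iff matrix_vector_right_distrib)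

lemma sys_output_scaleR:
  "sys_output C D (\<lambda>t. r *\<^sub>R x t) (\<lambda>t. r *\<^sub>R u t) = (\<lambda>t. r *\<^sub>R sys_output C D x u t)"
  by (simp add: sys_output_def fun_eq_iff matrix_vector_scaleR scaleR_add_right)

lemma sys_output_diff:
  "sys_output C D (\<lambda>t. x t - y t) (\<lambda>t. u t - v t) = (\<lambda>t. sys_output C D x u t - sys_output C D y v t)"
  by (simp add: sys_output_def fun_eq_iff matrix_vector_mult_diff_distrib)

lemma l2_sys_output:
  assumes "feasible A B a x u"
  shows "l2 (sys_output C D x u)"
  unfolding sys_output_def using assms
  by (auto simp: feasible_iff intro!: l2_add l2_bounded_linear[OF matrix_vector_mul_bounded_linear])

section \<open>The determinant condition and the vanishing of the output energy\<close>

lemma blockm_mult_stackv: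
  "blockm M11 M12 M21 M22 *v stackv x u = stackv (M11 *v x + M12 *v u) (M21 *v x + M22 *v u)"
  by (auto simp: blockm_def stackv_def matrix_vector_mult_def vec_eq_iff sum.Plus
      simp flip: UNIV_Plus_UNIV split: sum.split)

lemma stackv_eq_0_iff: "stackv x u = 0 \<longleftrightarrow> x = 0 \<and> u = 0"
  by (auto simp: stackv_def vec_eq_iff split: sum.splits)

lemma invertible_iff_ker:
  fixes M :: "complex^'n^'n"
  shows "invertible M \<longleftrightarrow> (\<forall>x. M *v x = 0 \<longrightarrow> x = 0)"
  by (simp add: invertible_left_inverse matrix_left_invertible_ker)

text \<open>A sequence is sought because energy 0 need not be attained: the closed loop that keeps
  the output at 0 may have eigenvalues on the unit circle.\<close>

lemma vanishing_output:
  fixes A :: "complex^'n^'n" and B :: "complex^'m^'n"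
    and C :: "complex^'n^'m" and D :: "complex^'m^'m" and K :: "complex^'n^'m"
  assumes stab: "\<And>z. cmod z \<ge> 1 \<Longrightarrow> invertible (mat z - A - B ** K)"
    and detc: "\<And>lam. cmod lam < 1 \<Longrightarrow>
      det (blockm (mat lam ** A - mat 1) (mat lam ** B) C D) \<noteq> 0"
  shows "\<exists>xs us. (\<forall>k. feasible A B a (xs k) (us k)) \<and>
    (\<lambda>k. energy (sys_output C D (xs k) (us k))) \<longlonglongrightarrow> 0"
proof -
  \<comment> \<open>The determinant condition as a trivial kernel; \<open>lam = 0\<close> will give
    injectivity of \<open>D\<close>.\<close>
  have ker: "\<xi> = 0 \<and> w = 0"
    if "cmod lam < 1" "lam *s (A *v \<xi> + B *v w) = \<xi>" "C *v \<xi> + D *v w = 0" for lam \<xi> w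
  proof -
    have "blockm (mat lam ** A - mat 1) (mat lam ** B) C D *v stackv \<xi> w = 0"
      using that(2,3)
      by (simp add: blockm_mult_stackv stackv_eq_0_iff matrix_vector_mult_diff_rdistrib
          mat_mult_vector vector_add_ldistrib diff_add_eq flip: matrix_vector_mul_assoc)
    then have "stackv \<xi> w = 0"
      using detc[OF that(1)] by (metis invertible_det_nz invertible_iff_ker)
    then show ?thesis
      by (simp add: stackv_eq_0_iff)
  qed
  have "invertible D"
    unfolding invertible_iff_ker using ker[of 0 0] by simp
  then obtain E where E: "\<And>w. D *v (E *v w) = w"
    using invertible_mult_vector_eq by blast
  \<comment> \<open>The state map under the input \<open>- (E *v (C *v \<xi>))\<close>, which makes
    the output zero.\<close>
  define M where "M = A - B ** (E ** C)"
  have M: "M *v \<xi> = A *v \<xi> + B *v (- (E *v (C *v \<xi>)))" for \<xi>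
    by (simp add: M_def matrix_vector_mult_diff_rdistrib vec.neg matrix_vector_mul_assoc)
  have M_inv: "invertible (mat c - M)" if "cmod c > 1" for c
    unfolding invertible_iff_ker
  proof (intro allI impI)
    fix \<xi> assume "(mat c - M) *v \<xi> = 0"
    then have "M *v \<xi> = c *s \<xi>"
      by (simp add: matrix_vector_mult_diff_rdistrib mat_mult_vector)
    moreover have "c \<noteq> 0" using that by auto
    \<comment> \<open>An eigenvector of \<open>M\<close> for \<open>c\<close> lies in the kernel
      above with \<open>lam = inverse c\<close>, which is inside the open disc.\<close>
    ultimately have "inverse c *s (A *v \<xi> + B *v (- (E *v (C *v \<xi>)))) = \<xi>"
      by (simp flip: M)
    moreover have "cmod (inverse c) < 1"
      using that by (simp add: norm_inverse inverse_less_1_iff)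
    moreover have "C *v \<xi> + D *v (- (E *v (C *v \<xi>))) = 0"
      by (simp add: vec.neg E)
    ultimately show "\<xi> = 0"
      using ker by blast
  qed

  have ex: "\<exists>x u. feasible A B \<xi> x u" for \<xi>
    using feasible_exists[OF stab] .
  define S where "S = {sys_output C D x u | x u. feasible A B a x u}"
  have aff: "(\<lambda>t. y t + r *\<^sub>R (z t - w t)) \<in> S" if yzw: "y \<in> S" "z \<in> S" "w \<in> S" for y z w r
  proof -
    obtain x1 u1 x2 u2 x3 u3 where
      "feasible A B a x1 u1" "feasible A B a x2 u2" "feasible A B a x3 u3"
      and eq: "y = sys_output C D x1 u1" "z = sys_output C D x2 u2" "w = sys_output C D x3 u3"
      using yzw unfolding S_def by blast
    then have "feasible A B a (\<lambda>t. x1 t + r *\<^sub>R (x2 t - x3 t)) (\<lambda>t. u1 t + r *\<^sub>R (u2 t - u3 t))"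
      using feasible_add[OF _ feasible_scaleR[OF feasible_diff], of A B a x1 u1 a x2 u2 a x3 u3 r]
      by simp
    then show ?thesis
      unfolding S_def eq by (force simp: sys_output_add sys_output_scaleR sys_output_diff)
  qed
  have "S \<noteq> {}"
    using ex by (auto simp: S_def)
  moreover have "l2 y" if "y \<in> S" for y
    using that l2_sys_output by (auto simp: S_def)
  ultimately have "\<exists>Y z. (\<forall>k. Y k \<in> S) \<and> l2 z \<and> (\<lambda>k. energy (\<lambda>t. Y k t - z t)) \<longlonglongrightarrow> 0
      \<and> (\<forall>y\<in>S. \<forall>w\<in>S. ip z (\<lambda>t. y t - w t) = 0)"
    by (rule minimal_energy_limit[OF _ _ aff])
  then obtain Y z where Y: "\<And>k. Y k \<in> S" and z: "l2 z"
    and lim: "(\<lambda>k. energy (\<lambda>t. Y k t - z t)) \<longlonglongrightarrow> 0"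
    and orth: "\<And>y w. y \<in> S \<Longrightarrow> w \<in> S \<Longrightarrow> ip z (\<lambda>t. y t - w t) = 0"
    by blast

  have z_shift: "l2 (\<lambda>s. z (s + t))" for t
    by (rule l2_shift[OF z])
  have orth_shift: "ip (\<lambda>s. z (s + t)) (sys_output C D x u) = 0" if "feasible A B 0 x u" for t x u
    using that
  proof (induction t arbitrary: x u)
    case 0
    obtain x0 u0 where f: "feasible A B a x0 u0"
      using ex by blast
    have "sys_output C D (\<lambda>t. x0 t + x t) (\<lambda>t. u0 t + u t) \<in> S"
      using feasible_add[OF f 0] by (auto simp: S_def)
    moreover have "sys_output C D x0 u0 \<in> S"
      using f by (auto simp: S_def)
    ultimately show ?case
      using orth[of "sys_output C D (\<lambda>t. x0 t + x t) (\<lambda>t. u0 t + u t)" "sys_output C D x0 u0"]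
      by (simp add: sys_output_add)
  next
    case (Suc t)
    \<comment> \<open>Starting with state 0 and input 0 delays the trajectory by one step with
      output 0, so the case \<open>t\<close> applied to it is the case \<open>Suc t\<close> for the
      original.\<close>
    then have f: "feasible A B 0 (case_nat 0 x) (case_nat 0 u)"
      by (intro feasible_cons) simp
    have "0 = ip (\<lambda>s. z (s + t)) (sys_output C D (case_nat 0 x) (case_nat 0 u))"
      using Suc.IH[OF f] by simp
    also have "\<dots> = ip (\<lambda>s. z (s + Suc t)) (sys_output C D x u)"
      unfolding ip_Suc[OF z_shift l2_sys_output[OF f]]
      by (simp add: sys_output_def [abs_def])
    finally show ?case by simp
  qed
  from ex have "\<forall>\<xi>. \<exists>x u. feasible A B \<xi> x u"
    by blast
  then obtain X U where XU: "\<And>\<xi>. feasible A B \<xi> (X \<xi>) (U \<xi>)"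
    unfolding choice_iff by blast
  define p where "p t \<xi> = ip (\<lambda>s. z (s + t)) (sys_output C D (X \<xi>) (U \<xi>))" for t \<xi>
  \<comment> \<open>Two trajectories from the same state differ by one from 0, whose output is
    orthogonal to every shift of \<open>z\<close>; hence the choice of \<open>X\<close> and
    \<open>U\<close> does not matter.\<close>
  have p_eq: "p t \<xi> = ip (\<lambda>s. z (s + t)) (sys_output C D x u)" if f: "feasible A B \<xi> x u" for t \<xi> x u
  proof -
    have "feasible A B 0 (\<lambda>t. X \<xi> t - x t) (\<lambda>t. U \<xi> t - u t)"
      using feasible_diff[OF XU[of \<xi>] f] by simp
    then have f0: "ip (\<lambda>s. z (s + t)) (\<lambda>s. sys_output C D (X \<xi>) (U \<xi>) s - sys_output C D x u s) = 0"
      unfolding sys_output_diff[symmetric] by (rule orth_shift)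
    have "ip (\<lambda>s. z (s + t)) (\<lambda>s. sys_output C D x u s + (sys_output C D (X \<xi>) (U \<xi>) s - sys_output C D x u s))
        = ip (\<lambda>s. z (s + t)) (sys_output C D x u)"
      unfolding ip_add_right[OF z_shift l2_sys_output[OF f] l2_diff[OF l2_sys_output[OF XU] l2_sys_output[OF f]]] f0
      by simp
    then show ?thesis
      by (simp add: p_def)
  qed
  have p_step: "p t \<xi> = z t \<bullet> (C *v \<xi> + D *v w) + p (Suc t) (A *v \<xi> + B *v w)" for t \<xi> w
  proof -
    obtain x u where f: "feasible A B (A *v \<xi> + B *v w) x u"
      using ex by blast
    note f' = feasible_cons[OF f]
    show ?thesis
      unfolding p_eq[OF f] p_eq[OF f'] ip_Suc[OF z_shift l2_sys_output[OF f']]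
      by (simp add: sys_output_def [abs_def])
  qed
  have "p t \<xi> = 0" for t \<xi>
  proof (rule costate_zero[of p M])
    show "linear (p t)" for t
    proof (rule linearI)
      fix \<xi> \<eta> r
      note f = XU[of \<xi>] and g = XU[of \<eta>]
      show "p t (\<xi> + \<eta>) = p t \<xi> + p t \<eta>"
        unfolding p_eq[OF f] p_eq[OF g] p_eq[OF feasible_add[OF f g]] sys_output_add
        by (intro ip_add_right z_shift l2_sys_output[OF f] l2_sys_output[OF g])
      show "p t (r *\<^sub>R \<xi>) = r *\<^sub>R p t \<xi>"
        unfolding p_eq[OF f] p_eq[OF feasible_scaleR[OF f]] sys_output_scaleR
        by (simp add: ip_scaleR_right z_shift l2_sys_output[OF f])
    qed
    \<comment> \<open>With the input that makes the output zero, the stage term of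
      \<open>p_step\<close> disappears.\<close>
    show "p t \<xi> = p (Suc t) (M *v \<xi>)" for t \<xi>
      using p_step[of t \<xi> "- (E *v (C *v \<xi>))"] by (simp add: M vec.neg E)
    show "(\<lambda>t. p t \<xi>) \<longlonglongrightarrow> 0" for \<xi>
    proof -
      obtain x u where f: "feasible A B \<xi> x u"
        using ex by blast
      show ?thesis
        unfolding p_eq[OF f] by (rule ip_shift_tendsto_zero[OF z l2_sys_output[OF f]])
    qed
  qed (fact M_inv)
  \<comment> \<open>From state 0 the input \<open>E *v z t\<close> produces the output
    \<open>z t\<close>, so \<open>p_step\<close> reduces to the vanishing of
    \<open>z t \<bullet> z t\<close>.\<close>
  then have "z t = 0" for t
    using p_step[of t 0 "E *v z t"] by (simp add: E)
  then have "(\<lambda>k. energy (Y k)) \<longlonglongrightarrow> 0"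
    using lim by simp
  moreover from Y have "\<forall>k. \<exists>x u. Y k = sys_output C D x u \<and> feasible A B a x u"
    by (simp add: S_def)
  then obtain xs us where "\<And>k. Y k = sys_output C D (xs k) (us k)" "\<And>k. feasible A B a (xs k) (us k)"
    unfolding choice_iff by blast
  ultimately show ?thesis by auto
qed

section \<open>From output energy to the cost\<close>

lemma Phi_eq_energy:
  fixes A :: "complex^'n^'n" and B :: "complex^'m^'n"
    and C :: "complex^'n^'m" and D :: "complex^'m^'m"
  assumes lur: "\<And>x u. sigma Q x u + qf P x - qf P (A *v x + B *v u)
                    = complex_of_real ((norm (C *v x + D *v u))\<^sup>2)"
    and f: "feasible A B a x u"
  shows "Phi Q x u = energy (sys_output C D x u) - Re (qf P a)"
proof -
  \<comment> \<open>Square-summability removes the boundary term at infinity, so the telescoping sum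
    leaves only the initial value of the quadratic form.\<close>
  have "x \<longlonglongrightarrow> 0"
    using f by (simp add: feasible_iff l2_tendsto_zero)
  then have "(\<lambda>t. Re (qf P (x t))) \<longlonglongrightarrow> Re (qf P 0)"
    unfolding qf_def by (intro tendsto_intros)
  moreover have "x 0 = a" "qf P 0 = 0"
    using f by (simp_all add: feasible_iff qf_def)
  ultimately have "(\<lambda>t. Re (qf P (x (Suc t))) - Re (qf P (x t))) sums (0 - Re (qf P a))"
    using telescope_sums[of "\<lambda>t. Re (qf P (x t))" 0] by (simp del: diff_0)
  moreover have "(\<lambda>t. (norm (sys_output C D x u t))\<^sup>2) sums energy (sys_output C D x u)"
    using l2_sys_output[OF f] unfolding energy_def l2_def by (rule summable_sums)
  ultimately have "(\<lambda>t. (norm (sys_output C D x u t))\<^sup>2 + (Re (qf P (x (Suc t))) - Re (qf P (x t))))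
      sums (energy (sys_output C D x u) + (0 - Re (qf P a)))"
    by (intro sums_add)
  moreover have "Re (sigma Q (x t) (u t))
      = (norm (sys_output C D x u t))\<^sup>2 + (Re (qf P (x (Suc t))) - Re (qf P (x t)))" for t
    using arg_cong[OF lur[of "x t" "u t"], of Re] f by (simp add: feasible_iff sys_output_def)
  ultimately show ?thesis
    unfolding Phi_def by (simp add: sums_iff)
qed

theorem theorem1p2:
  fixes A :: "complex^'n^'n" and B :: "complex^'m^'n"
    and Q :: "complex^('n + 'm)^('n + 'm)"
    and P :: "complex^'n^'n" and C :: "complex^'n^'m" and D :: "complex^'m^'m"
    and a :: "complex^'n"
  assumes stab: "\<exists>K :: complex^'n^'m. \<forall>z. cmod z \<ge> 1 \<longrightarrow> invertible (mat z - A - B ** K)"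
    and Qh: "cadj Q = Q"
    and Pi_pos: "finite {z. cmod z = 1 \<and> \<not> (invertible (mat z - A) \<and> cposdef (Pifun A B Q z))}"
    and Ph: "cadj P = P"
    and lur: "\<forall>x u. sigma Q x u + qf P x - qf P (A *v x + B *v u)
                    = complex_of_real ((norm (C *v x + D *v u))\<^sup>2)"
    and detc: "\<forall>lam. cmod lam < 1 \<longrightarrow> det (blockm (mat lam ** A - mat 1) (mat lam ** B) C D) \<noteq> 0"
  shows "Inf {Phi Q x u | x u. feasible A B a x u} = - Re (qf P a)
       \<and> (\<forall>xs us. (\<forall>i::nat. feasible A B a (xs i) (us i)) \<longrightarrow>
            ((\<lambda>i. \<Sum>t. (norm (C *v xs i t + D *v us i t))\<^sup>2) \<longlonglongrightarrow> 0
             \<longleftrightarrow> (\<lambda>i. Phi Q (xs i) (us i)) \<longlonglongrightarrow> - Re (qf P a)))"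
proof (intro conjI allI impI)
  note Phi = Phi_eq_energy[OF lur[rule_format]]
  obtain K :: "complex^'n^'m" where K: "\<And>z. cmod z \<ge> 1 \<Longrightarrow> invertible (mat z - A - B ** K)"
    using stab by blast
  obtain xs us where f: "\<And>k. feasible A B a (xs k) (us k)"
    and lim: "(\<lambda>k. energy (sys_output C D (xs k) (us k))) \<longlonglongrightarrow> 0"
    using vanishing_output[OF K detc[rule_format]] by blast
  have "(\<lambda>k. Phi Q (xs k) (us k)) \<longlonglongrightarrow> 0 - Re (qf P a)"
    unfolding Phi[OF f] by (intro tendsto_diff lim tendsto_const)
  then have limPhi: "(\<lambda>k. Phi Q (xs k) (us k)) \<longlonglongrightarrow> - Re (qf P a)"
    by simp
  show "Inf {Phi Q x u | x u. feasible A B a x u} = - Re (qf P a)"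
  \<comment> \<open>The value is shown to be the greatest lower bound of a nonempty set, so
    \<open>Inf\<close> is a genuine infimum: nonnegative energy gives the lower bound, and the
    sequence with vanishing output gives its optimality.\<close>
  proof (rule cInf_eq_non_empty)
    show "{Phi Q x u | x u. feasible A B a x u} \<noteq> {}"
      using f by blast
    show "- Re (qf P a) \<le> c" if "c \<in> {Phi Q x u | x u. feasible A B a x u}" for c
      using that by (auto simp: Phi intro!: energy_nonneg l2_sys_output)
    show "b \<le> - Re (qf P a)" if "\<And>c. c \<in> {Phi Q x u | x u. feasible A B a x u} \<Longrightarrow> b \<le> c" for b
      using that f by (intro LIMSEQ_le_const[OF limPhi]) blast
  qed
next
  note Phi = Phi_eq_energy[OF lur[rule_format]]
  fix xs :: "nat \<Rightarrow> nat \<Rightarrow> complex^'n" and us :: "nat \<Rightarrow> nat \<Rightarrow> complex^'m"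
  assume f: "\<forall>i. feasible A B a (xs i) (us i)"
  \<comment> \<open>Cost and output energy differ by a constant independent of \<open>i\<close>, so
    both limits are equivalent.\<close>
  have "Phi Q (xs i) (us i) = - Re (qf P a) + (\<Sum>t. (norm (C *v xs i t + D *v us i t))\<^sup>2)" for i
    using Phi[OF f[rule_format]] by (simp add: energy_def sys_output_def)
  then show "(\<lambda>i. \<Sum>t. (norm (C *v xs i t + D *v us i t))\<^sup>2) \<longlonglongrightarrow> 0
      \<longleftrightarrow> (\<lambda>i. Phi Q (xs i) (us i)) \<longlonglongrightarrow> - Re (qf P a)"
    using tendsto_add_const_iff[of "- Re (qf P a)" _ 0 sequentially] by simp
qed

end
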